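(* Let $0<x_1<x_2<\cdots$ be an infinite sequence of integers (trap positions on $\mathbb{Z}_{>0}$). If $x_k=O(\rho^k)$ as $k\to\infty$ for some real $\rho<\dfrac{3+\sqrt5}{2}$, then the model with traps $(x_k)_{k\ge1}$ is non-critical.
   Context: The model is the trapped random walk on the half-line: with $D_+=\{x_k\}_{k\ge1}$, it is the Markov chain on $\{0,1,2,\dots\}\cup\{s\}$ where $s$ (the sink) and $0$ are absorbing, from $x\ge 1$ with $x\notin D_+$ the walk moves to $x-1$ or $x+1$ with probability $1/2$ each, and from $x\in D_+$ it moves to $x-1$, $x+1$ or $s$ with probability $1/3$ each. Let $T$ be the first time the walk is in $\{0,s\}$, and let $\mathbb{E}_x(T)\in[0,\infty]$ be its expectation for the walk started at $x$. The model is called critical if $\mathbb{E}_1(T)=\infty$ and non-critical if $\mathbb{E}_1(T)<\infty$ (the finiteness of $\mathbb{E}_x(T)$ does not depend on the starting point $x\ge 1$). *)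

theory Defs
  imports "HOL-Probability.Probability" "HOL-Library.Landau_Symbols"
begin

datatype site = Site nat | Sink

text \<open>The set \<open>D\<close> is the set of trap positions. A trap placed at \<open>0\<close> would have no effect.
  In both uniform laws below the listed sites are pairwise distinct, since \<open>x \<ge> 1\<close> there.\<close>

fun walk_step :: "nat set \<Rightarrow> site \<Rightarrow> site pmf" where
  "walk_step D Sink = return_pmf Sink"
| "walk_step D (Site x) =
     (if x = 0 then return_pmf (Site 0)
      else if x \<notin> D then pmf_of_set {Site (x - 1), Site (x + 1)}
      else pmf_of_set {Site (x - 1), Site (x + 1), Sink})"

abbreviation site_space :: "site measure" where
  "site_space \<equiv> count_space UNIV"

abbreviation path_space :: "(nat \<Rightarrow> site) measure" where
  "path_space \<equiv> PiM UNIV (\<lambda>_. site_space)"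

text \<open>The law of the chain at time \<open>n\<close>, given its values at the times before \<open>n\<close>.\<close>

definition walk_kernel :: "nat set \<Rightarrow> site \<Rightarrow> nat \<Rightarrow> (nat \<Rightarrow> site) \<Rightarrow> site measure" where
  "walk_kernel D x n \<omega> =
     measure_pmf (case n of 0 \<Rightarrow> return_pmf x | Suc m \<Rightarrow> walk_step D (\<omega> m))"

lemma measurable_walk_kernel:
  "walk_kernel D x n \<in> measurable (PiM {0..<n} (\<lambda>_. site_space)) (subprob_algebra site_space)"
proof (cases n)
  case 0
  have "(\<lambda>_. measure_pmf (return_pmf x)) \<in>
      measurable (PiM {0..<n} (\<lambda>_. site_space)) (subprob_algebra site_space)"
    by (rule measurable_const) (rule measure_pmf_in_subprob_algebra)
  then show ?thesis
    by (simp only: walk_kernel_def[abs_def] 0 nat.case)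
next
  case (Suc m)
  have "(\<lambda>\<omega>. \<omega> m) \<in> measurable (PiM {0..<n} (\<lambda>_. site_space)) site_space"
    by (rule measurable_component_singleton) (simp add: Suc)
  moreover have "(\<lambda>s. measure_pmf (walk_step D s)) \<in> measurable site_space (subprob_algebra site_space)"
    unfolding measurable_count_space_eq1 by (intro Pi_I measure_pmf_in_subprob_algebra)
  ultimately have "(\<lambda>\<omega>. measure_pmf (walk_step D (\<omega> m))) \<in>
      measurable (PiM {0..<n} (\<lambda>_. site_space)) (subprob_algebra site_space)"
    by (rule measurable_compose)
  then show ?thesis
    by (simp only: walk_kernel_def[abs_def] Suc nat.case)
qed

lemma prob_space_walk_kernel: "prob_space (walk_kernel D x n \<omega>)"
  unfolding walk_kernel_def by (rule prob_space_measure_pmf)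

interpretation walk: Ionescu_Tulcea "walk_kernel D x" "\<lambda>_. site_space" for D x
  by (rule Ionescu_Tulcea.intro) (rule measurable_walk_kernel, rule prob_space_walk_kernel)

text \<open>The law on path space of the Markov chain with transition probabilities \<open>walk_step D\<close>
  started at \<open>x\<close>, obtained from the theorem of Ionescu-Tulcea. The lemma
  \<open>emeasure_walk_law_cylinder\<close> gives its finite-dimensional distributions.\<close>

definition walk_law :: "nat set \<Rightarrow> site \<Rightarrow> (nat \<Rightarrow> site) measure" where
  "walk_law D x = walk.PF.lim D x"

lemma sets_walk_law [simp, measurable_cong]: "sets (walk_law D x) = sets path_space"
  by (simp add: walk_law_def)

lemma space_walk_law [simp]: "space (walk_law D x) = UNIV"
  by (simp add: walk_law_def space_PiM)

lemma cylinder_sets: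
  assumes "finite J"
  shows "{restrict a J} \<in> sets (PiM J (\<lambda>_. site_space))"
proof -
  have "{restrict a J} = PiE J (\<lambda>i. {a i})"
    by (auto simp: PiE_def Pi_def extensional_def restrict_def fun_eq_iff)
  also have "\<dots> \<in> sets (PiM J (\<lambda>_. site_space))"
    using assms by (intro sets_PiM_I_finite) auto
  finally show ?thesis .
qed

lemma emeasure_walk_C:
  "emeasure (walk.C D x 0 (Suc n) (\<lambda>_. undefined)) {restrict a {0..<Suc n}} =
     (if a 0 = x then (\<Prod>i<n. ennreal (pmf (walk_step D (a i)) (a (Suc i)))) else 0)"
proof -
  have step: "emeasure (walk.C D x 0 (Suc n) (\<lambda>_. undefined)) {restrict a {0..<Suc n}} =
      emeasure (walk_kernel D x n (restrict a {0..<n})) {a n} *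
      emeasure (walk.C D x 0 n (\<lambda>_. undefined)) {restrict a {0..<n}}" for n
  proof -
    let ?u = "\<lambda>_. undefined :: site"
    let ?C = "walk.C D x 0 n ?u"
    have u: "?u \<in> space (PiM {0..<0::nat} (\<lambda>_. site_space))"
      by (simp add: space_PiM)
    have "emeasure (walk.C D x 0 (Suc n) ?u) {restrict a {0..<Suc n}} =
        (\<integral>\<^sup>+\<omega>. emeasure (walk.eP D x n \<omega>) {restrict a {0..<Suc n}} \<partial>?C)"
      unfolding walk.C.simps add_0
    proof (rule emeasure_bind)
      show "space ?C \<noteq> {}"
        using walk.prob_space_C[OF u] by (rule prob_space.not_empty)
      show "walk.eP D x n \<in> measurable ?C (subprob_algebra (PiM {0..<Suc n} (\<lambda>_. site_space)))"
        using walk.measurable_eP[of D x n] walk.sets_C[OF u, of D x n]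
        by (simp cong: measurable_cong_sets)
    qed (rule cylinder_sets, simp)
    also have "\<dots> = (\<integral>\<^sup>+\<omega>. emeasure (walk_kernel D x n (restrict a {0..<n})) {a n} *
        indicator {restrict a {0..<n}} \<omega> \<partial>?C)"
    proof (rule nn_integral_cong)
      fix \<omega> assume "\<omega> \<in> space ?C"
      then have w: "\<omega> \<in> space (PiM {0..<n} (\<lambda>_. site_space))"
        by (simp add: walk.space_C[OF u])
      then have undef: "\<omega> i = undefined" if "\<not> i < n" for i
        using that by (auto simp: space_PiM PiE_def extensional_def)
      have fupd_iff: "(fun_upd \<omega> n s = restrict a {0..<Suc n}) \<longleftrightarrow>
          \<omega> = restrict a {0..<n} \<and> s = a n" for s
      proof
        assume eq: "fun_upd \<omega> n s = restrict a {0..<Suc n}"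
        have "\<omega> i = restrict a {0..<n} i" for i
          using fun_cong[OF eq, of i] undef[of i] by (cases "i < n") (auto simp: restrict_def)
        moreover have "s = a n"
          using fun_cong[OF eq, of n] by simp
        ultimately show "\<omega> = restrict a {0..<n} \<and> s = a n" by blast
      next
        assume eq: "\<omega> = restrict a {0..<n} \<and> s = a n"
        show "fun_upd \<omega> n s = restrict a {0..<Suc n}"
          by (rule ext) (auto simp: eq restrict_def)
      qed
      have "(\<lambda>s. fun_upd \<omega> n s) -` {restrict a {0..<Suc n}} =
          (if \<omega> = restrict a {0..<n} then {a n} else {})"
        by (auto simp del: restrict_apply simp: fupd_iff vimage_def)
      then show "emeasure (walk.eP D x n \<omega>) {restrict a {0..<Suc n}} =
          emeasure (walk_kernel D x n (restrict a {0..<n})) {a n} *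
          indicator {restrict a {0..<n}} \<omega>"
        by (subst walk.emeasure_eP[OF w cylinder_sets]) auto
    qed
    also have "\<dots> = emeasure (walk_kernel D x n (restrict a {0..<n})) {a n} *
        emeasure ?C {restrict a {0..<n}}"
      by (rule nn_integral_cmult_indicator) (simp add: walk.sets_C[OF u] cylinder_sets)
    finally show ?thesis .
  qed
  show ?thesis
  proof (induction n)
    case 0
    have "emeasure (walk.C D x 0 0 (\<lambda>_. undefined)) {restrict a {0..<0}} = 1"
      by (simp add: restrict_def space_PiM PiM_empty)
    then show ?case
      by (subst step) (simp add: walk_kernel_def emeasure_pmf_single)
  next
    case (Suc n)
    show ?case
      by (subst step, subst Suc.IH)
        (simp add: walk_kernel_def emeasure_pmf_single mult.commute)
  qed
qed

lemma emeasure_walk_law_cylinder: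
  "emeasure (walk_law D x) {\<omega>. \<forall>i\<le>n. \<omega> i = a i} =
     (if a 0 = x then (\<Prod>i<n. ennreal (pmf (walk_step D (a i)) (a (Suc i)))) else 0)"
proof -
  let ?J = "{0..<Suc n}"
  have "{\<omega>. \<forall>i\<le>n. \<omega> i = a i} = prod_emb UNIV (\<lambda>_. site_space) ?J {restrict a ?J}"
    by (auto simp: prod_emb_def restrict_def fun_eq_iff less_Suc_eq_le) metis
  then have "emeasure (walk_law D x) {\<omega>. \<forall>i\<le>n. \<omega> i = a i} =
      emeasure (walk.CI D x ?J) {restrict a ?J}"
    unfolding walk_law_def by (simp only:) (rule walk.lim, simp, rule cylinder_sets, simp)
  also have "\<dots> = emeasure (walk.C D x 0 (Suc n) (\<lambda>_. undefined)) {restrict a ?J}"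
    by (subst walk.emeasure_CI[of ?J "Suc n"])
      (auto simp: cylinder_sets prod_emb_id space_PiM PiE_iff simp del: walk.C.simps)
  finally show ?thesis
    by (simp only: emeasure_walk_C)
qed

lemma prob_space_walk_law: "prob_space (walk_law D x)"
proof
  have "emeasure (walk_law D x) (prod_emb UNIV (\<lambda>_. site_space) {} {\<lambda>_. undefined}) =
      emeasure (walk.CI D x {}) {\<lambda>_. undefined}"
    unfolding walk_law_def by (rule walk.lim) (auto simp: PiM_empty)
  also have "\<dots> = emeasure (walk.CI D x {}) (space (walk.CI D x {}))"
    by (subst walk.PF.space_P) (auto simp: space_PiM)
  also have "\<dots> = 1"
    by (rule prob_space.emeasure_space_1) (rule walk.PF.prob_space_P, auto)
  finally show "emeasure (walk_law D x) (space (walk_law D x)) = 1"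
    by (simp add: prod_emb_def space_PiM restrict_def)
qed

text \<open>The first time in \<open>{0, s}\<close>. It is \<open>\<infinity>\<close>, the infimum of the empty set, if there is none.\<close>

definition absorption_time :: "(nat \<Rightarrow> site) \<Rightarrow> ennreal" where
  "absorption_time \<omega> = (INF n \<in> {n. \<omega> n \<in> {Site 0, Sink}}. of_nat n)"

lemma borel_measurable_absorption_time [measurable]:
  "absorption_time \<in> borel_measurable path_space"
proof -
  have "absorption_time = (\<lambda>\<omega>. INF n. if \<omega> n \<in> {Site 0, Sink} then of_nat n else \<infinity>)"
  proof (intro ext antisym)
    fix \<omega> :: "nat \<Rightarrow> site"
    let ?A = "{n. \<omega> n \<in> {Site 0, Sink}}"
    let ?f = "\<lambda>n. if \<omega> n \<in> {Site 0, Sink} then of_nat n else (\<infinity> :: ennreal)"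
    show "absorption_time \<omega> \<le> (INF n. ?f n)"
      unfolding absorption_time_def
    proof (rule INF_greatest)
      fix n
      show "(INF n\<in>?A. of_nat n) \<le> ?f n"
      proof (cases "n \<in> ?A")
        case True
        then have "?f n = of_nat n" by simp
        with INF_lower[OF True, of "of_nat :: nat \<Rightarrow> ennreal"] show ?thesis by simp
      qed simp
    qed
    show "(INF n. ?f n) \<le> absorption_time \<omega>"
      unfolding absorption_time_def
    proof (rule INF_greatest)
      fix n assume "n \<in> ?A"
      then have "?f n = of_nat n" by simp
      with INF_lower[of n UNIV ?f] show "(INF n. ?f n) \<le> of_nat n" by simp
    qed
  qed
  also have "\<dots> \<in> borel_measurable path_space"
  proof -
    have [measurable]: "Measurable.pred path_space (\<lambda>\<omega>. \<omega> n \<in> {Site 0, Sink})" for n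
      by (rule measurable_compose[OF measurable_component_singleton]) simp_all
    show ?thesis by measurable
  qed
  finally show ?thesis .
qed

definition expected_absorption_time :: "nat set \<Rightarrow> nat \<Rightarrow> ennreal" where
  "expected_absorption_time D x = (\<integral>\<^sup>+\<omega>. absorption_time \<omega> \<partial>walk_law D (Site x))"

definition critical :: "nat set \<Rightarrow> bool" where
  "critical D \<longleftrightarrow> expected_absorption_time D 1 = \<infinity>"

definition non_critical :: "nat set \<Rightarrow> bool" where
  "non_critical D \<longleftrightarrow> expected_absorption_time D 1 < \<infinity>"

end

theory Submission
  imports Defs
begin

text \<open>Let \<open>f\<close> be the solution of \<open>f 0 = 0\<close>, \<open>f 1 = 1\<close> that is harmonic for the walk killed at the traps.
  At the site \<open>y\<close> the step to \<open>y + 1\<close> increases the slope of \<open>f\<close> by \<open>f y\<close> if \<open>y\<close> is a trap and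
  leaves it unchanged otherwise, so comparison with traps at consecutive sites shows that the
  slope is at least of order \<open>\<phi> ^ (2 * k)\<close> after \<open>k\<close> traps, where \<open>\<phi>\<close> is the golden ratio and
  \<open>\<phi>\<^sup>2 = (3 + \<surd>5) / 2\<close>. The functions \<open>min (f y) (f z)\<close> of \<open>y\<close> are superharmonic, with a
  decrement at \<open>y = z\<close> of the order of the slope of \<open>f\<close> at \<open>z\<close>. Hence
  \<open>V y = (\<Sum>z. 3 * min (f y) (f z) / (f z - f (z - 1)))\<close> is a Lyapunov function that bounds the
  expected absorption time, and it is finite because \<open>x\<^sub>k = O(\<rho>\<^sup>k)\<close> with \<open>\<rho> < \<phi>\<^sup>2\<close> makes the slope
  at \<open>z\<close> grow at least like \<open>z\<^sup>\<beta>\<close> for some \<open>\<beta> > 1\<close>.\<close>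

section \<open>Lyapunov functions bound the expected absorption time\<close>

definition walk_pmf :: "nat set \<Rightarrow> site \<Rightarrow> nat \<Rightarrow> site pmf" where
  "walk_pmf D x n = ((\<lambda>p. bind_pmf p (walk_step D)) ^^ n) (return_pmf x)"

lemma walk_pmf_simps:
  "walk_pmf D x 0 = return_pmf x"
  "walk_pmf D x (Suc n) = bind_pmf (walk_pmf D x n) (walk_step D)"
  by (simp_all add: walk_pmf_def)

text \<open>Countability lets events be split over the values of finitely many coordinates and laws
  be compared point by point.\<close>

instance site :: countable
  by countable_datatype

lemma measurable_coordinate_walk_law [measurable]:
  "(\<lambda>\<omega>. \<omega> n) \<in> measurable (walk_law D x) site_space"
  by measurable

lemma coordinate_set_measurable:
  "{\<omega>. P (\<omega> i)} \<in> sets (walk_law D x)"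
proof -
  have "(\<lambda>\<omega>. \<omega> i) -` {s. P s} \<inter> space (walk_law D x) \<in> sets (walk_law D x)"
    by (rule measurable_sets[OF measurable_coordinate_walk_law]) simp
  then show ?thesis by (simp add: vimage_def)
qed

lemma cylinder_measurable:
  "{\<omega>. \<forall>i\<le>n. \<omega> i = a i} \<in> sets (walk_law D x)"
proof -
  have "{\<omega>. \<forall>i\<le>n. \<omega> i = a i} = (\<Inter>i\<in>{..n}. {\<omega>. \<omega> i = a i})"
    by auto
  also have "\<dots> \<in> sets (walk_law D x)"
    by (intro sets.finite_INT coordinate_set_measurable) auto
  finally show ?thesis .
qed

text \<open>Taking \<open>B\<close> inside \<open>PiE\<close> gives each cylinder exactly one
  representative, so the event is a countable disjoint union of cylinders, whose probabilities are
  known.\<close>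

lemma emeasure_walk_law_sum_cylinders:
  assumes "B \<subseteq> PiE {..n} (\<lambda>_. UNIV)"
  shows "emeasure (walk_law D x) {\<omega>. restrict \<omega> {..n} \<in> B} =
    (\<integral>\<^sup>+a. emeasure (walk_law D x) {\<omega>. \<forall>i\<le>n. \<omega> i = a i} \<partial>count_space B)"
proof -
  have eq: "restrict \<omega> {..n} = a \<longleftrightarrow> (\<forall>i\<le>n. \<omega> i = a i)" if "a \<in> B" for \<omega> a
    using that assms by (auto simp: fun_eq_iff restrict_def PiE_def extensional_def subset_eq)
  have B: "{\<omega>. restrict \<omega> {..n} \<in> B} = (\<Union>a\<in>B. {\<omega>. \<forall>i\<le>n. \<omega> i = a i})"
  proof (intro equalityI subsetI)
    fix \<omega> assume "\<omega> \<in> {\<omega>. restrict \<omega> {..n} \<in> B}"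
    then show "\<omega> \<in> (\<Union>a\<in>B. {\<omega>. \<forall>i\<le>n. \<omega> i = a i})"
      by (intro UN_I[of "restrict \<omega> {..n}"]) simp_all
  next
    fix \<omega> assume "\<omega> \<in> (\<Union>a\<in>B. {\<omega>. \<forall>i\<le>n. \<omega> i = a i})"
    then obtain a where "a \<in> B" "\<forall>i\<le>n. \<omega> i = a i" by blast
    with eq[of a \<omega>] show "\<omega> \<in> {\<omega>. restrict \<omega> {..n} \<in> B}" by simp
  qed
  have "disjoint_family_on (\<lambda>a. {\<omega>. \<forall>i\<le>n. \<omega> i = a i}) B"
    unfolding disjoint_family_on_def
  proof (intro ballI impI equals0I)
    fix a b \<omega> assume "a \<in> B" "b \<in> B" "a \<noteq> b"
      and "\<omega> \<in> {\<omega>. \<forall>i\<le>n. \<omega> i = a i} \<inter> {\<omega>. \<forall>i\<le>n. \<omega> i = b i}"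
    then have "restrict \<omega> {..n} = a" "restrict \<omega> {..n} = b"
      using eq[of a \<omega>] eq[of b \<omega>] by blast+
    with \<open>a \<noteq> b\<close> show False by simp
  qed
  moreover have "countable B"
    by (rule countable_subset[OF assms], rule countable_PiE) auto
  ultimately show ?thesis
    unfolding B by (intro emeasure_UN_countable cylinder_measurable)
qed

text \<open>In the cylinder formula the last factor depends only on the last two values, so it comes
  out of the sum over all pasts ending in \<open>z\<close>.\<close>

lemma emeasure_walk_law_markov:
  "emeasure (walk_law D x) {\<omega>. \<omega> n = z \<and> \<omega> (Suc n) = y} =
    emeasure (walk_law D x) {\<omega>. \<omega> n = z} * ennreal (pmf (walk_step D z) y)"
proof -
  let ?M = "walk_law D x"
  define B where "B = {a \<in> PiE {..n} (\<lambda>_. UNIV :: site set). a n = z}"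
  define B' where "B' = {a \<in> PiE {..Suc n} (\<lambda>_. UNIV :: site set). a n = z \<and> a (Suc n) = y}"
  have B: "{\<omega>. \<omega> n = z} = {\<omega>. restrict \<omega> {..n} \<in> B}"
    by (auto simp: B_def)
  have B': "{\<omega>. \<omega> n = z \<and> \<omega> (Suc n) = y} = {\<omega>. restrict \<omega> {..Suc n} \<in> B'}"
    by (auto simp: B'_def)
  \<comment> \<open>Extending a past by \<open>y\<close> moves the sum over \<open>B'\<close> to the
    index set \<open>B\<close>.\<close>
  have bij: "bij_betw (\<lambda>a. a(Suc n := y)) B B'"
  proof (rule bij_betw_byWitness[where f' = "\<lambda>a. restrict a {..n}"])
    show "\<forall>a\<in>B. restrict (a(Suc n := y)) {..n} = a"
      by (auto simp: B_def fun_eq_iff PiE_def extensional_def)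
    show "\<forall>a\<in>B'. (restrict a {..n})(Suc n := y) = a"
      by (auto simp: B'_def fun_eq_iff PiE_def extensional_def)
    show "(\<lambda>a. a(Suc n := y)) ` B \<subseteq> B'"
      by (auto simp: B_def B'_def PiE_def extensional_def)
    show "(\<lambda>a. restrict a {..n}) ` B' \<subseteq> B"
      by (auto simp: B_def B'_def)
  qed
  have "emeasure ?M {\<omega>. \<omega> n = z \<and> \<omega> (Suc n) = y} =
      (\<integral>\<^sup>+a. emeasure ?M {\<omega>. \<forall>i\<le>Suc n. \<omega> i = a i} \<partial>count_space B')"
    unfolding B' by (rule emeasure_walk_law_sum_cylinders) (auto simp: B'_def)
  also have "\<dots> = (\<integral>\<^sup>+a. emeasure ?M {\<omega>. \<forall>i\<le>Suc n. \<omega> i = (a(Suc n := y)) i} \<partial>count_space B)"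
    by (rule nn_integral_bij_count_space[OF bij, symmetric])
  also have "\<dots> = (\<integral>\<^sup>+a. emeasure ?M {\<omega>. \<forall>i\<le>n. \<omega> i = a i} *
      ennreal (pmf (walk_step D z) y) \<partial>count_space B)"
  proof (rule nn_integral_cong)
    fix a assume "a \<in> space (count_space B)"
    then have "a n = z" by (simp add: B_def)
    moreover have "(\<Prod>i<n. ennreal (pmf (walk_step D ((a(Suc n := y)) i)) ((a(Suc n := y)) (Suc i)))) =
        (\<Prod>i<n. ennreal (pmf (walk_step D (a i)) (a (Suc i))))"
      by (rule prod.cong) auto
    ultimately show "emeasure ?M {\<omega>. \<forall>i\<le>Suc n. \<omega> i = (a(Suc n := y)) i} =
        emeasure ?M {\<omega>. \<forall>i\<le>n. \<omega> i = a i} * ennreal (pmf (walk_step D z) y)"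
      unfolding emeasure_walk_law_cylinder by simp
  qed
  also have "\<dots> = (\<integral>\<^sup>+a. emeasure ?M {\<omega>. \<forall>i\<le>n. \<omega> i = a i} \<partial>count_space B) *
      ennreal (pmf (walk_step D z) y)"
    by (rule nn_integral_multc) simp
  also have "(\<integral>\<^sup>+a. emeasure ?M {\<omega>. \<forall>i\<le>n. \<omega> i = a i} \<partial>count_space B) = emeasure ?M {\<omega>. \<omega> n = z}"
    unfolding B by (rule emeasure_walk_law_sum_cylinders[symmetric]) (auto simp: B_def)
  finally show ?thesis .
qed

text \<open>By the Markov property the point masses obey the recursion that defines
  \<open>walk_pmf\<close>.\<close>

lemma distr_walk_law_coordinate:
  "distr (walk_law D x) site_space (\<lambda>\<omega>. \<omega> n) = measure_pmf (walk_pmf D x n)"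
proof -
  let ?M = "walk_law D x"
  have point: "emeasure ?M {\<omega>. \<omega> n = y} = ennreal (pmf (walk_pmf D x n) y)" for y
  proof (induction n arbitrary: y)
    case 0
    show ?case
      using emeasure_walk_law_cylinder[of D x 0 "\<lambda>_. y"] by (simp add: walk_pmf_simps)
  next
    case (Suc n)
    have "{\<omega>. \<omega> (Suc n) = y} = (\<Union>z. {\<omega>. \<omega> n = z \<and> \<omega> (Suc n) = y})"
      by auto
    also have "emeasure ?M \<dots> =
        (\<integral>\<^sup>+z. emeasure ?M {\<omega>. \<omega> n = z \<and> \<omega> (Suc n) = y} \<partial>count_space UNIV)"
    proof (rule emeasure_UN_countable)
      show "{\<omega>. \<omega> n = z \<and> \<omega> (Suc n) = y} \<in> sets ?M" for z
        using sets.Int[OF coordinate_set_measurable coordinate_set_measurable]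
        by (simp add: Collect_conj_eq)
    qed (auto simp: disjoint_family_on_def)
    also have "\<dots> = (\<integral>\<^sup>+z. ennreal (pmf (walk_pmf D x n) z) * ennreal (pmf (walk_step D z) y)
        \<partial>count_space UNIV)"
      by (simp only: emeasure_walk_law_markov Suc.IH)
    also have "\<dots> = (\<integral>\<^sup>+z. ennreal (pmf (walk_step D z) y) \<partial>measure_pmf (walk_pmf D x n))"
      by (simp add: nn_integral_measure_pmf)
    also have "\<dots> = ennreal (pmf (walk_pmf D x (Suc n)) y)"
      by (simp add: walk_pmf_simps ennreal_pmf_bind)
    finally show ?case .
  qed
  show ?thesis
  proof (rule measure_eqI_countable[where A = UNIV])
    fix y
    show "emeasure (distr ?M site_space (\<lambda>\<omega>. \<omega> n)) {y} = emeasure (walk_pmf D x n) {y}"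
      by (subst emeasure_distr) (auto simp: vimage_def point emeasure_pmf_single)
  qed auto
qed

text \<open>Each time before absorption counts 1 on the right. As an inequality this holds for every
  path, even one that leaves an absorbing site.\<close>

lemma absorption_time_le_sum:
  "absorption_time \<omega> \<le> (\<Sum>n. indicator (- {Site 0, Sink}) (\<omega> n))"
proof (cases "\<exists>n. \<omega> n \<in> {Site 0, Sink}")
  case True
  define m where "m = (LEAST n. \<omega> n \<in> {Site 0, Sink})"
  have m: "\<omega> m \<in> {Site 0, Sink}"
    unfolding m_def using True by (rule LeastI_ex)
  have "\<omega> i \<notin> {Site 0, Sink}" if "i < m" for i
    using that not_less_Least unfolding m_def by blast
  then have "of_nat m = (\<Sum>i<m. indicator (- {Site 0, Sink}) (\<omega> i) :: ennreal)"
    by simp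
  also have "\<dots> \<le> (\<Sum>n. indicator (- {Site 0, Sink}) (\<omega> n))"
    by (rule sum_le_suminf) auto
  finally have "of_nat m \<le> (\<Sum>n. indicator (- {Site 0, Sink}) (\<omega> n) :: ennreal)" .
  moreover have "absorption_time \<omega> \<le> of_nat m"
    unfolding absorption_time_def using m by (intro INF_lower) simp
  ultimately show ?thesis by simp
next
  case False
  then have "(\<Sum>n. indicator (- {Site 0, Sink}) (\<omega> n)) = (\<Sum>n. 1 :: ennreal)"
    by (intro suminf_cong) auto
  also have "\<dots> = \<top>"
    by (simp add: suminf_eq_SUP ennreal_SUP_of_nat_eq_top)
  finally show ?thesis by simp
qed

lemma expected_absorption_time_le_lyapunov:
  assumes "\<And>s. indicator (- {Site 0, Sink}) s + (\<integral>\<^sup>+t. V t \<partial>walk_step D s) \<le> V s"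
  shows "expected_absorption_time D y \<le> V (Site y)"
proof -
  let ?I = "indicator (- {Site 0, Sink}) :: site \<Rightarrow> ennreal"
  let ?p = "walk_pmf D (Site y)"
  have partial: "(\<Sum>n<N. \<integral>\<^sup>+s. ?I s \<partial>?p n) + (\<integral>\<^sup>+s. V s \<partial>?p N) \<le> V (Site y)" for N
  proof (induction N)
    case 0
    show ?case by (simp add: walk_pmf_simps)
  next
    case (Suc N)
    have "(\<integral>\<^sup>+s. ?I s \<partial>?p N) + (\<integral>\<^sup>+s. V s \<partial>?p (Suc N)) =
        (\<integral>\<^sup>+s. ?I s + (\<integral>\<^sup>+t. V t \<partial>walk_step D s) \<partial>?p N)"
      by (simp add: walk_pmf_simps nn_integral_bind_pmf nn_integral_add)
    also have "\<dots> \<le> (\<integral>\<^sup>+s. V s \<partial>?p N)"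
      by (intro nn_integral_mono assms)
    finally have "(\<Sum>n<N. \<integral>\<^sup>+s. ?I s \<partial>?p n) + ((\<integral>\<^sup>+s. ?I s \<partial>?p N) + (\<integral>\<^sup>+s. V s \<partial>?p (Suc N))) \<le>
        (\<Sum>n<N. \<integral>\<^sup>+s. ?I s \<partial>?p n) + (\<integral>\<^sup>+s. V s \<partial>?p N)"
      by (rule add_left_mono)
    from order_trans[OF this Suc.IH] show ?case
      by (simp add: add.assoc)
  qed
  have marginal: "(\<integral>\<^sup>+\<omega>. ?I (\<omega> n) \<partial>walk_law D (Site y)) = (\<integral>\<^sup>+s. ?I s \<partial>?p n)" for n
    unfolding distr_walk_law_coordinate[symmetric]
    by (rule nn_integral_distr[symmetric]) auto
  have "expected_absorption_time D y \<le> (\<integral>\<^sup>+\<omega>. (\<Sum>n. ?I (\<omega> n)) \<partial>walk_law D (Site y))"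
    unfolding expected_absorption_time_def by (intro nn_integral_mono absorption_time_le_sum)
  also have "\<dots> = (\<Sum>n. \<integral>\<^sup>+\<omega>. ?I (\<omega> n) \<partial>walk_law D (Site y))"
    by (rule nn_integral_suminf) (rule measurable_compose[OF measurable_coordinate_walk_law], simp)
  also have "\<dots> = (\<Sum>n. \<integral>\<^sup>+s. ?I s \<partial>?p n)"
    by (simp only: marginal)
  also have "\<dots> \<le> V (Site y)"
    unfolding suminf_eq_SUP
  proof (rule SUP_least)
    fix N
    show "(\<Sum>n<N. \<integral>\<^sup>+s. ?I s \<partial>?p n) \<le> V (Site y)"
      using partial[of N] by (rule order_trans[rotated]) (simp only: le_iff_add, blast)
  qed
  finally show ?thesis .
qed

section \<open>The harmonic function of the killed walk\<close>

text \<open>The mean-value equation with value 0 at the sink, multiplied by the number of possible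
  steps: 3 at a trap and 2 elsewhere.\<close>

fun killed_harmonic :: "nat set \<Rightarrow> nat \<Rightarrow> real" where
  "killed_harmonic D 0 = 0"
| "killed_harmonic D (Suc 0) = 1"
| "killed_harmonic D (Suc (Suc n)) =
     (if Suc n \<in> D then 3 else 2) * killed_harmonic D (Suc n) - killed_harmonic D n"

definition harmonic_slope :: "nat set \<Rightarrow> nat \<Rightarrow> real" where
  "harmonic_slope D n = killed_harmonic D (Suc n) - killed_harmonic D n"

lemma killed_harmonic_Suc:
  "killed_harmonic D (Suc n) = killed_harmonic D n + harmonic_slope D n"
  by (simp add: harmonic_slope_def)

lemma harmonic_slope_Suc:
  "harmonic_slope D (Suc n) =
    harmonic_slope D n + (if Suc n \<in> D then killed_harmonic D (Suc n) else 0)"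
  by (simp add: harmonic_slope_def)

declare killed_harmonic.simps(3) [simp del]

section \<open>Golden-ratio lower bound for the slope\<close>

definition golden :: real where
  "golden = (1 + sqrt 5) / 2"

lemma golden_pos: "golden > 0"
  by (simp add: golden_def add_pos_pos)

lemma golden_ge_1: "golden \<ge> 1"
  by (simp add: golden_def)

lemma golden_square: "golden\<^sup>2 = golden + 1"
  by (simp add: golden_def power2_eq_square field_simps)

lemma golden_square_eq: "golden\<^sup>2 = (3 + sqrt 5) / 2"
  unfolding golden_square by (simp add: golden_def field_simps)

text \<open>A trap at \<open>Suc n\<close> first affects the slope at \<open>Suc n\<close>, so the
  slope at \<open>n\<close> reflects precisely the traps in \<open>{1..n}\<close>.\<close>

definition traps_upto :: "nat set \<Rightarrow> nat \<Rightarrow> nat" where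
  "traps_upto D n = card (D \<inter> {1..n})"

lemma traps_upto_0 [simp]: "traps_upto D 0 = 0"
  by (simp add: traps_upto_def)

lemma traps_upto_Suc:
  "traps_upto D (Suc n) = (if Suc n \<in> D then Suc (traps_upto D n) else traps_upto D n)"
  by (simp add: traps_upto_def atLeastAtMostSuc_conv)

text \<open>The vector \<open>(1, \<phi>)\<close> is the Perron eigenvector, with eigenvalue \<open>\<phi>\<^sup>2\<close>, of the map
  \<open>(f, d) \<mapsto> (f + d, f + 2 * d)\<close> that describes consecutive traps. The exponent of the slope
  bound would be \<open>2 * k - 1\<close>; the factor \<open>\<phi>\<close> on the left avoids truncated subtraction.\<close>

lemma killed_harmonic_growth:
  "golden ^ (2 * traps_upto D n) \<le> golden * harmonic_slope D n \<and>
   golden ^ (2 * traps_upto D n) \<le> killed_harmonic D (Suc n)"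
proof (induction n)
  case 0
  show ?case
    using golden_ge_1 by (simp add: harmonic_slope_def)
next
  case (Suc n)
  let ?P = "golden ^ (2 * traps_upto D n)"
  let ?f = "killed_harmonic D (Suc n)" and ?d = "harmonic_slope D n"
  have IH: "?P \<le> golden * ?d" "?P \<le> ?f"
    using Suc.IH by auto
  have "?d \<ge> 0"
  proof -
    have "0 \<le> golden * ?d"
      using IH(1) golden_pos by (meson order_trans zero_le_power less_imp_le)
    then show ?thesis
      using golden_pos by (simp add: zero_le_mult_iff)
  qed
  show ?case
  proof (cases "Suc n \<in> D")
    case False
    then show ?thesis
      using IH \<open>?d \<ge> 0\<close> killed_harmonic_Suc[of D "Suc n"] harmonic_slope_Suc[of D n] traps_upto_Suc[of D n]
      by simp
  next
    case True
    have P: "golden ^ (2 * traps_upto D (Suc n)) = ?P * (golden + 1)"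
      using True by (simp add: traps_upto_Suc golden_square[symmetric] power2_eq_square)
    have slope: "harmonic_slope D (Suc n) = ?d + ?f"
      using True by (simp add: harmonic_slope_Suc)
    have "golden * ?P \<le> golden * ?f"
      using IH(2) golden_pos by simp
    with IH(1) have 1: "?P * (golden + 1) \<le> golden * (?d + ?f)"
      by (simp add: algebra_simps)
    \<comment> \<open>The bound for the next value of the function needs \<open>?d + ?f\<close>
      without the factor \<open>golden\<close>; writing \<open>golden + 1\<close> as a square lets
      one factor cancel.\<close>
    have "golden * (golden * ?P) = ?P * (golden + 1)"
      unfolding golden_square[symmetric] by (simp add: power2_eq_square)
    with 1 have "golden * (golden * ?P) \<le> golden * (?d + ?f)"
      by (simp only:)
    then have "golden * ?P \<le> ?d + ?f"
      using golden_pos by simp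
    with IH(2) have "?P * (golden + 1) \<le> ?f + (?d + ?f)"
      by (simp add: algebra_simps)
    with 1 show ?thesis
      unfolding P slope killed_harmonic_Suc[of D "Suc n"] by simp
  qed
qed

lemma harmonic_slope_pos: "harmonic_slope D n > 0"
proof -
  have "0 < golden * harmonic_slope D n"
    using killed_harmonic_growth[of D n] golden_pos by (meson less_le_trans zero_less_power)
  then show ?thesis
    using golden_pos by (simp add: zero_less_mult_iff)
qed

lemma killed_harmonic_mono: "m \<le> n \<Longrightarrow> killed_harmonic D m \<le> killed_harmonic D n"
  by (rule lift_Suc_mono_le[of "killed_harmonic D"])
    (auto simp: killed_harmonic_Suc less_imp_le[OF harmonic_slope_pos])

lemma killed_harmonic_nonneg: "0 \<le> killed_harmonic D n"
  using killed_harmonic_mono[of 0 n D] by simp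

section \<open>The Lyapunov function\<close>

text \<open>The cap sits at \<open>Suc n\<close>, so the denominator is the last slope below it. The
  factor 3 serves both step laws, whose required decrement is 2 or 3.\<close>

definition green_term :: "nat set \<Rightarrow> nat \<Rightarrow> nat \<Rightarrow> real" where
  "green_term D n y =
     3 * min (killed_harmonic D y) (killed_harmonic D (Suc n)) / harmonic_slope D n"

lemma green_term_nonneg: "0 \<le> green_term D n y"
  by (simp add: green_term_def killed_harmonic_nonneg less_imp_le[OF harmonic_slope_pos])

lemma green_term_0 [simp]: "green_term D n 0 = 0"
  by (simp add: green_term_def killed_harmonic_nonneg min_absorb1)

text \<open>Below the cap the recursion gives equality. Above it all three values agree and
  \<open>m\<close> is at least 2. At the cap only the upper neighbour is cut down, which gains at
  least \<open>harmonic_slope D n\<close>.\<close>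

lemma green_term_superharmonic:
  fixes D y
  defines "m \<equiv> if Suc y \<in> D then 3 else (2 :: real)"
  shows "green_term D n y + green_term D n (Suc (Suc y)) + (if n = y then m else 0) \<le>
    m * green_term D n (Suc y)"
proof -
  let ?f = "killed_harmonic D" and ?d = "harmonic_slope D n"
  let ?h = "\<lambda>i. min (?f i) (?f (Suc n))"
  have d: "?d > 0" by (rule harmonic_slope_pos)
  have m: "2 \<le> m" "m \<le> 3" by (auto simp: m_def)
  have rec: "?f (Suc (Suc y)) = m * ?f (Suc y) - ?f y"
    by (simp add: m_def killed_harmonic.simps(3))
  have mono: "?f y \<le> ?f (Suc y)" "?f (Suc y) \<le> ?f (Suc (Suc y))"
    by (rule killed_harmonic_mono, simp)+
  have "3 * (?h y + ?h (Suc (Suc y))) + (if n = y then m * ?d else 0) \<le> 3 * (m * ?h (Suc y))"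
  proof (cases n y rule: linorder_cases)
    case less
    then have "?f (Suc n) \<le> ?f y"
      by (intro killed_harmonic_mono) simp
    then have "?h y = ?f (Suc n)" "?h (Suc y) = ?f (Suc n)" "?h (Suc (Suc y)) = ?f (Suc n)"
      using mono by auto
    moreover have "2 * ?f (Suc n) \<le> m * ?f (Suc n)"
      using m by (intro mult_right_mono killed_harmonic_nonneg) auto
    ultimately show ?thesis using less by simp
  next
    case greater
    then have "?f (Suc (Suc y)) \<le> ?f (Suc n)"
      by (intro killed_harmonic_mono) simp
    then have "?h y = ?f y" "?h (Suc y) = ?f (Suc y)" "?h (Suc (Suc y)) = ?f (Suc (Suc y))"
      using mono by auto
    then show ?thesis using greater rec by simp
  next
    case equal
    then have h: "?h y = ?f y" "?h (Suc y) = ?f (Suc y)" "?h (Suc (Suc y)) = ?f (Suc y)"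
      using mono by auto
    have "m * ?d \<le> 3 * ?d"
      using m d by (intro mult_right_mono) auto
    also have "\<dots> = 3 * (?f (Suc y) - ?f y)"
      using equal by (simp add: harmonic_slope_def)
    finally have "m * ?d \<le> 3 * (?f (Suc y) - ?f y)" .
    moreover have "2 * ?f (Suc y) \<le> m * ?f (Suc y)"
      using m by (intro mult_right_mono killed_harmonic_nonneg) auto
    ultimately show ?thesis unfolding h using equal by simp
  qed
  then show ?thesis
    using d by (simp add: green_term_def divide_simps split: if_splits)
qed

text \<open>In the sum over all caps, the term with its cap at a site supplies the unit drift
  required there. Capping also bounds each term by a constant over the slope, so the sum
  converges.\<close>

lemma non_critical_if_summable_inverse_slope:
  assumes "summable (\<lambda>n. 1 / harmonic_slope D n)"
  shows "non_critical D"
proof -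
  define W where "W y = (\<Sum>n. green_term D n y)" for y
  have summ: "summable (\<lambda>n. green_term D n y)" for y
  proof (rule summable_comparison_test')
    show "summable (\<lambda>n. 3 * killed_harmonic D y * (1 / harmonic_slope D n))"
      by (intro summable_mult assms)
    show "norm (green_term D n y) \<le> 3 * killed_harmonic D y * (1 / harmonic_slope D n)"
      if "n \<ge> 0" for n
    proof -
      have "green_term D n y \<le> 3 * killed_harmonic D y / harmonic_slope D n"
        unfolding green_term_def
        by (intro divide_right_mono less_imp_le[OF harmonic_slope_pos]) simp
      then show ?thesis
        using green_term_nonneg[of D n y] by simp
    qed
  qed
  have W0: "W 0 = 0" by (simp add: W_def)
  have W_nonneg: "W y \<ge> 0" for y
    unfolding W_def by (intro suminf_nonneg summ green_term_nonneg)
  have super: "W y + W (Suc (Suc y)) + m \<le> m * W (Suc y)"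
    if m: "m = (if Suc y \<in> D then 3 else 2)" for y m
  proof -
    have single: "(\<lambda>n. if n = y then m else 0) sums m"
      using sums_single[of y "\<lambda>_. m"] by simp
    have "(\<lambda>n. green_term D n y + green_term D n (Suc (Suc y)) + (if n = y then m else 0)) sums
        (W y + W (Suc (Suc y)) + m)"
      unfolding W_def by (intro sums_add single summable_sums summ)
    moreover have "(\<lambda>n. m * green_term D n (Suc y)) sums (m * W (Suc y))"
      unfolding W_def by (intro sums_mult summable_sums summ)
    ultimately show ?thesis
      by (rule sums_le[rotated]) (simp only: m green_term_superharmonic)
  qed
  \<comment> \<open>The value 0 at the sink matches the killing in the harmonic recursion.\<close>
  define V where "V s = (case s of Sink \<Rightarrow> 0 | Site y \<Rightarrow> ennreal (W y))" for s
  have "expected_absorption_time D 1 \<le> V (Site 1)"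
  proof (rule expected_absorption_time_le_lyapunov)
    fix s
    show "indicator (- {Site 0, Sink}) s + (\<integral>\<^sup>+t. V t \<partial>walk_step D s) \<le> V s"
    proof (cases s)
      case Sink
      then show ?thesis by (simp add: V_def)
    next
      case (Site z)
      show ?thesis
      proof (cases z)
        case 0
        then show ?thesis using Site by (simp add: V_def W0)
      next
        case (Suc y)
        have V: "V (Site i) = ennreal (W i)" "V Sink = ennreal 0" for i
          by (simp_all add: V_def)
        show ?thesis
        proof (cases "Suc y \<in> D")
          case True
          have "1 + (W y + W (Suc (Suc y))) / 3 \<le> W (Suc y)"
            using super[of 3 y] True by (simp add: field_simps)
          moreover have "(\<integral>\<^sup>+t. V t \<partial>walk_step D s) = ennreal ((W y + W (Suc (Suc y))) / 3)"
            using Site Suc True W_nonneg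
            by (simp add: nn_integral_pmf_of_set V ennreal_plus[symmetric] divide_ennreal[symmetric]
                del: ennreal_plus)
          ultimately show ?thesis
            using Site Suc W_nonneg
            by (simp add: V ennreal_1[symmetric] ennreal_plus[symmetric] del: ennreal_plus ennreal_1)
        next
          case False
          have "1 + (W y + W (Suc (Suc y))) / 2 \<le> W (Suc y)"
            using super[of 2 y] False by (simp add: field_simps)
          moreover have "(\<integral>\<^sup>+t. V t \<partial>walk_step D s) = ennreal ((W y + W (Suc (Suc y))) / 2)"
            using Site Suc False W_nonneg
            by (simp add: nn_integral_pmf_of_set V ennreal_plus[symmetric] divide_ennreal[symmetric]
                del: ennreal_plus)
          ultimately show ?thesis
            using Site Suc W_nonneg
            by (simp add: V ennreal_1[symmetric] ennreal_plus[symmetric] del: ennreal_plus ennreal_1)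
        qed
      qed
    qed
  qed
  also have "\<dots> < \<infinity>" by (simp add: V_def)
  finally show ?thesis by (simp add: non_critical_def)
qed

section \<open>Geometrically bounded trap positions\<close>

text \<open>Let \<open>k\<close> be the number of traps up to \<open>n\<close>. Otherwise
  \<open>x 1\<close>, ..., \<open>x (Suc k)\<close> would be \<open>k + 1\<close> distinct traps in
  \<open>{1..n}\<close>.\<close>

lemma less_enumeration_traps_upto:
  fixes x :: "nat \<Rightarrow> nat"
  assumes "0 < x 1" and "\<And>k. 1 \<le> k \<Longrightarrow> x k < x (Suc k)"
  shows "n < x (Suc (traps_upto (x ` {1..}) n))"
proof (rule ccontr)
  let ?k = "traps_upto (x ` {1..}) n"
  assume "\<not> n < x (Suc ?k)"
  \<comment> \<open>The index shift keeps out \<open>x 0\<close>, about which nothing is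
    assumed.\<close>
  have less: "x i < x j" if "1 \<le> i" "i < j" for i j
    using that lift_Suc_mono_less[of "\<lambda>k. x (Suc k)" "i - 1" "j - 1"] assms(2) by simp
  have "inj_on x {1..Suc ?k}"
  proof (rule linorder_inj_onI)
    show "x i \<noteq> x j" if "i < j" "i \<in> {1..Suc ?k}" for i j
      using less[of i j] that by simp
  qed auto
  have "x ` {1..Suc ?k} \<subseteq> x ` {1..} \<inter> {1..n}"
  proof
    fix y assume "y \<in> x ` {1..Suc ?k}"
    then obtain j where j: "y = x j" "1 \<le> j" "j \<le> Suc ?k" by auto
    have "x 1 \<le> x j" using less[of 1 j] j by (cases "j = 1") auto
    moreover have "x j \<le> x (Suc ?k)" using less[of j "Suc ?k"] j by (cases "j = Suc ?k") auto
    ultimately show "y \<in> x ` {1..} \<inter> {1..n}"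
      using j assms(1) \<open>\<not> n < x (Suc ?k)\<close> by auto
  qed
  then have "card (x ` {1..Suc ?k}) \<le> ?k"
    unfolding traps_upto_def by (intro card_mono) auto
  with \<open>inj_on x {1..Suc ?k}\<close> show False
    by (simp add: card_image)
qed

theorem theorem2p7:
  fixes x :: "nat \<Rightarrow> nat" and \<rho> :: real
  assumes "0 < x 1"
    and "\<And>k. 1 \<le> k \<Longrightarrow> x k < x (Suc k)"
    and "0 < \<rho>"
    and "\<rho> < (3 + sqrt 5) / 2"
    and "(\<lambda>k. real (x k)) \<in> O(\<lambda>k. \<rho> ^ k)"
  shows "non_critical (x ` {1..})"
proof (rule non_critical_if_summable_inverse_slope)
  let ?D = "x ` {1..}"
  let ?d = "harmonic_slope ?D"
  obtain c where c: "c > 0" and ev: "eventually (\<lambda>k. norm (real (x k)) \<le> c * norm (\<rho> ^ k)) at_top"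
    using landau_o.bigE[OF assms(5)] by blast
  obtain K where K: "real (x k) \<le> c * \<rho> ^ k" if "k \<ge> K" for k
    using ev \<open>0 < \<rho>\<close> unfolding eventually_at_top_linorder by auto
  have mono: "x i \<le> x j" if "1 \<le> i" "i \<le> j" for i j
    using that lift_Suc_mono_le[of "\<lambda>k. x (Suc k)" "i - 1" "j - 1"] assms(2)
    by (simp add: less_imp_le)
  have x_ge: "k \<le> x k" if "1 \<le> k" for k
    using that
  proof (induction k rule: dec_induct)
    case base
    show ?case using assms(1) by simp
  next
    case (step k)
    then show ?case using assms(2)[of k] by simp
  qed
  \<comment> \<open>This makes \<open>ln \<rho>\<close> positive. Otherwise \<open>x k\<close> would
    eventually be bounded by \<open>c\<close>, although it is at least \<open>k\<close>.\<close>
  have "\<rho> > 1"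
  proof (rule ccontr)
    assume "\<not> \<rho> > 1"
    obtain N :: nat where N: "c < real N"
      using reals_Archimedean2 by blast
    let ?k = "Suc (max K N)"
    have "real ?k \<le> real (x ?k)"
      using x_ge[of ?k] by simp
    also have "\<dots> \<le> c * \<rho> ^ ?k"
      by (rule K) simp
    also have "\<dots> \<le> c"
      using c \<open>0 < \<rho>\<close> \<open>\<not> \<rho> > 1\<close> power_le_one[of \<rho> ?k] by (simp only: mult_left_le)
    finally show False using N by simp
  qed
  \<comment> \<open>Chosen so that \<open>\<rho> powr \<beta>\<close> is
    \<open>golden\<^sup>2\<close>, the growth factor per trap; it exceeds 1 because \<rho> lies
    below that factor.\<close>
  define \<beta> where "\<beta> = ln (golden\<^sup>2) / ln \<rho>"
  have "\<rho> < golden\<^sup>2"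
    using assms(4) by (simp add: golden_square_eq)
  then have "ln \<rho> < ln (golden\<^sup>2)"
    using \<open>0 < \<rho>\<close> by (simp only: ln_less_cancel_iff[of \<rho> "golden\<^sup>2"] order_less_trans)
  then have "\<beta> > 1"
    using \<open>\<rho> > 1\<close> by (simp add: \<beta>_def)
  have \<rho>_powr: "\<rho> powr \<beta> = golden\<^sup>2"
    using \<open>\<rho> > 1\<close> golden_pos by (simp add: powr_def \<beta>_def)
  \<comment> \<open>With \<open>k\<close> traps up to \<open>n\<close>, the position
    \<open>n\<close> is below \<open>c * \<rho> ^ Suc k\<close>, so its power \<beta> is at most a
    constant times \<open>golden ^ (2 * k)\<close>, which the slope dominates. The threshold makes
    \<open>n\<close> positive and \<open>Suc k\<close> at least \<open>K\<close>.\<close>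
  have bound: "1 / ?d n \<le> golden * (c * \<rho>) powr \<beta> * real n powr (- \<beta>)" if n: "n \<ge> Suc (x K + x 1)" for n
  proof -
    define k where "k = traps_upto ?D n"
    have lt: "n < x (Suc k)"
      unfolding k_def by (rule less_enumeration_traps_upto[OF assms(1,2)])
    have "K \<le> Suc k"
    proof (rule ccontr)
      assume "\<not> K \<le> Suc k"
      then have "x (Suc k) \<le> x K" by (intro mono) auto
      with lt n show False by simp
    qed
    have "real n \<le> c * \<rho> * \<rho> ^ k"
      using K[OF \<open>K \<le> Suc k\<close>] lt by simp
    then have "real n powr \<beta> \<le> (c * \<rho> * \<rho> ^ k) powr \<beta>"
      using \<open>\<beta> > 1\<close> by (intro powr_mono2) auto
    also have "\<dots> = (c * \<rho>) powr \<beta> * (\<rho> powr \<beta>) ^ k"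
      using c \<open>0 < \<rho>\<close> by (simp add: powr_mult powr_power powr_realpow[symmetric] powr_powr mult.commute)
    also have "\<dots> = (c * \<rho>) powr \<beta> * golden ^ (2 * k)"
      by (simp add: \<rho>_powr power_mult)
    also have "\<dots> \<le> (c * \<rho>) powr \<beta> * (golden * ?d n)"
      using killed_harmonic_growth[of ?D n] by (intro mult_left_mono) (auto simp: k_def)
    finally have "real n powr \<beta> \<le> golden * (c * \<rho>) powr \<beta> * ?d n"
      by (simp add: mult_ac)
    then show ?thesis
      using harmonic_slope_pos[of ?D n] n by (simp add: powr_minus field_simps)
  qed
  show "summable (\<lambda>n. 1 / ?d n)"
  proof (rule summable_comparison_test'[where N = "Suc (x K + x 1)"])
    show "summable (\<lambda>n. golden * (c * \<rho>) powr \<beta> * real n powr (- \<beta>))"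
      using \<open>\<beta> > 1\<close> by (intro summable_mult) (simp add: summable_real_powr_iff)
    show "norm (1 / ?d n) \<le> golden * (c * \<rho>) powr \<beta> * real n powr (- \<beta>)"
      if "n \<ge> Suc (x K + x 1)" for n
      using bound[OF that] harmonic_slope_pos[of ?D n] by simp
  qed
qed

end
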